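(* Let $\epsilon\in(0,\frac12)$. For the Online Vector Packing Problem in which every weight vector lies in $[0,1-\epsilon]^d$, every deterministic online algorithm (even with unbounded computational power) has competitive ratio $\Omega(k)$, and every randomized online algorithm (even with unbounded computational power) has competitive ratio $\Omega(k/\log k)$; these lower bounds hold even when the utility function is $f(S)=|S|$.
   Context: Online Vector Packing Problem: there is a $d$-dimensional knapsack with capacity $1$ in each dimension. Items $u$ arrive online in an arbitrary (adversarial) order; the algorithm does not know the number of items in advance. Each item $u$ has a weight vector $\mathbf{w}_u\in[0,1]^d$, revealed upon arrival. Upon arrival of $u$, the algorithm must immediately decide whether to accept or discard $u$; it may also dispose of previously accepted items at no cost (free disposal), but discarded or disposed-of items can never be recovered. The set $S$ of currently accepted items must always satisfy $\sum_{u\in S}\mathbf{w}_u\le \mathbf{1}$. The utility of a set $S$ is $f(S)$ for a non-negative monotone submodular function $f$. If $S$ is the final set kept, $\mathrm{ALG}=f(S)$, and the competitive ratio is the worst case over instances of $\mathrm{OPT}/\mathbb{E}[\mathrm{ALG}]$, where $\mathrm{OPT}$ is the maximum utility of a feasible subset of all arrived items. The sparsity $k$ is the minimum number such that every weight vector has at most $k$ non-zero coordinates. *)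

theory Defs
  imports "HOL-Probability.Probability"
begin

text \<open>
  An instance of the Online Vector Packing Problem. Items are identified with their arrival
  positions \<open>0, 1, \<dots>\<close>; \<open>weights\<close> lists their weight vectors in order of arrival. A vector in
  \<open>d\<close> dimensions is a function on \<open>nat\<close> that vanishes outside \<open>{..<d}\<close>. Only the values of
  \<open>utility\<close> on sets of arrived items are meaningful.
\<close>

record ovp =
  dim :: nat
  weights :: "(nat \<Rightarrow> real) list"
  utility :: "nat set \<Rightarrow> real"

definition items :: "ovp \<Rightarrow> nat set" where
  "items I = {..<length (weights I)}"

definition nonneg_monotone_submodular :: "nat set \<Rightarrow> (nat set \<Rightarrow> real) \<Rightarrow> bool" where
  "nonneg_monotone_submodular U f \<longleftrightarrow>
     (\<forall>S\<subseteq>U. 0 \<le> f S) \<and>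
     (\<forall>T\<subseteq>U. \<forall>S\<subseteq>T. f S \<le> f T) \<and>
     (\<forall>S\<subseteq>U. \<forall>T\<subseteq>U. f (S \<union> T) + f (S \<inter> T) \<le> f S + f T)"

definition feasible :: "ovp \<Rightarrow> nat set \<Rightarrow> bool" where
  "feasible I S \<longleftrightarrow> S \<subseteq> items I \<and> (\<forall>i<dim I. (\<Sum>u\<in>S. (weights I ! u) i) \<le> 1)"

definition OPT :: "ovp \<Rightarrow> real" where
  "OPT I = Max (utility I ` {S. feasible I S})"

definition sparsity :: "ovp \<Rightarrow> nat" where
  "sparsity I = (LEAST k. \<forall>u\<in>items I. card {i. i < dim I \<and> (weights I ! u) i \<noteq> 0} \<le> k)"

definition ovp_instances :: "real \<Rightarrow> nat \<Rightarrow> ovp set" where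
  "ovp_instances \<epsilon> k =
     {I. (\<forall>u\<in>items I. (\<forall>i<dim I. (weights I ! u) i \<in> {0..1 - \<epsilon>}) \<and>
                       (\<forall>i\<ge>dim I. (weights I ! u) i = 0)) \<and>
         nonneg_monotone_submodular (items I) (utility I) \<and>
         sparsity I = k}"

definition cardinality_instances :: "real \<Rightarrow> nat \<Rightarrow> ovp set" where
  "cardinality_instances \<epsilon> k =
     {I \<in> ovp_instances \<epsilon> k. \<forall>S\<subseteq>items I. utility I S = real (card S)}"

text \<open>
  A deterministic algorithm maps what it has observed so far (the dimension of the knapsack, the
  weight vectors of the arrived items, and the utility function on sets of arrived items) to the
  set of items it currently keeps. Its earlier decisions are themselves determined by earlier
  observations, so they need not be passed as an argument.
\<close>

type_synonym algorithm = "nat \<Rightarrow> (nat \<Rightarrow> real) list \<Rightarrow> (nat set \<Rightarrow> real) \<Rightarrow> nat set"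

definition kept :: "algorithm \<Rightarrow> ovp \<Rightarrow> nat \<Rightarrow> nat set" where
  "kept A I t = A (dim I) (take t (weights I)) (restrict (utility I) (Pow {..<t}))"

text \<open>
  At step \<open>t\<close> only the arriving item \<open>t\<close> can be added; any kept item may be disposed of.
\<close>

definition online_algorithm :: "ovp set \<Rightarrow> algorithm \<Rightarrow> bool" where
  "online_algorithm \<I> A \<longleftrightarrow>
     (\<forall>I\<in>\<I>. kept A I 0 = {} \<and>
        (\<forall>t<length (weights I).
           kept A I (Suc t) \<subseteq> insert t (kept A I t) \<and> feasible I (kept A I (Suc t))))"

definition final_set :: "algorithm \<Rightarrow> ovp \<Rightarrow> nat set" where
  "final_set A I = kept A I (length (weights I))"

definition ALG :: "algorithm \<Rightarrow> ovp \<Rightarrow> real" where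
  "ALG A I = utility I (final_set A I)"

text \<open>
  A randomized algorithm is a probability distribution on deterministic online algorithms. The
  \<open>\<sigma>\<close>-algebra is arbitrary, provided that the final set is a random variable on every instance.
\<close>

definition randomized_online_algorithm :: "ovp set \<Rightarrow> algorithm measure \<Rightarrow> bool" where
  "randomized_online_algorithm \<I> M \<longleftrightarrow>
     prob_space M \<and>
     (\<forall>A\<in>space M. online_algorithm \<I> A) \<and>
     (\<forall>I\<in>\<I>. (\<lambda>A. final_set A I) \<in> measurable M (count_space UNIV))"

definition expected_ALG :: "algorithm measure \<Rightarrow> ovp \<Rightarrow> real" where
  "expected_ALG M I = (LINT A|M. ALG A I)"

text \<open>
  The second argument gives the (expected) utility obtained on each instance. In \<open>ereal\<close>,
  \<open>x / 0 = \<infinity>\<close> for \<open>x > 0\<close> and \<open>0 / 0 = 0\<close>.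
\<close>

definition competitive_ratio :: "ovp set \<Rightarrow> (ovp \<Rightarrow> real) \<Rightarrow> ereal" where
  "competitive_ratio \<I> alg = (SUP I\<in>\<I>. ereal (OPT I) / ereal (alg I))"

end

theory Submission
  imports Defs
begin

text \<open>
  All weights are \<open>0\<close> or \<open>1 - \<epsilon> > 1/2\<close>, so the problem becomes online set packing with supports of
  size \<open>k\<close>. Against a deterministic algorithm, every new item meets only the item that is currently
  held: the algorithm never holds two items, while the conflict graph of \<open>k\<close> items is a tree and
  has an independent set of size \<open>k / 2\<close>. Against a randomized algorithm, about \<open>k / ln k\<close> batches
  of at least \<open>k\<close> mutually conflicting items arrive, each with a secret random good item. Later
  items conflict with all bad items of earlier batches but not with the good ones; indexing the
  items of a batch by bit strings achieves this with about \<open>log k\<close> coordinates for each pair of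
  batches. The good items are compatible, whereas the algorithm keeps at most one bad item and
  guesses each good item with probability at most \<open>1 / k\<close>.
\<close>

section \<open>Ratio bounds from single instances, and general facts about online runs\<close>

lemma competitive_ratio_ge:
  assumes "I \<in> \<I>" "b \<le> OPT I" "0 < b" "0 \<le> alg I" "alg I \<le> a" "0 < a"
  shows "ereal (b / a) \<le> competitive_ratio \<I> alg"
proof -
  have "ereal (b / a) \<le> ereal (OPT I) / ereal (alg I)"
  \<comment> \<open>Real and \<open>ereal\<close> division differ at denominator 0; there the
    \<open>ereal\<close> quotient is infinite because \<open>OPT I\<close> is positive.\<close>
  proof (cases "alg I = 0")
    case True
    have "0 < OPT I" using assms(2,3) by simp
    with True show ?thesis by (simp add: divide_ereal_def)
  next
    case False
    then have "b / a \<le> OPT I / alg I"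
      using assms by (intro frac_le) auto
    then show ?thesis using False by simp
  qed
  also have "\<dots> \<le> competitive_ratio \<I> alg"
    unfolding competitive_ratio_def using assms(1) by (rule SUP_upper)
  finally show ?thesis .
qed

lemma feasible_kept:
  assumes "online_algorithm \<I> A" "I \<in> \<I>" "t \<le> length (weights I)"
  shows "feasible I (kept A I t)"
  using assms by (cases t) (auto simp: online_algorithm_def feasible_def)

lemma kept_subset_arrived:
  assumes "online_algorithm \<I> A" "I \<in> \<I>" "t \<le> length (weights I)"
  shows "kept A I t \<subseteq> {..<t}"
  using assms(3)
proof (induction t)
  case 0
  then show ?case using assms by (auto simp: online_algorithm_def)
next
  case (Suc t)
  have "kept A I (Suc t) \<subseteq> insert t (kept A I t)"
    using Suc.prems assms by (auto simp: online_algorithm_def)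
  with Suc show ?case by (auto simp: less_Suc_eq)
qed

text \<open>Lost items never return. This charges a good item in the final set to what is held at
  the end of its batch.\<close>

lemma kept_Int_arrived_subset:
  assumes "online_algorithm \<I> A" "I \<in> \<I>" "t \<le> t'" "t' \<le> length (weights I)"
  shows "kept A I t' \<inter> {..<t} \<subseteq> kept A I t"
  using assms(3,4)
proof (induction t' rule: dec_induct)
  case (step t')
  have "kept A I (Suc t') \<subseteq> insert t' (kept A I t')"
    using step assms by (auto simp: online_algorithm_def)
  with step show ?case by auto
qed simp

lemma final_set_subset_items:
  assumes "online_algorithm \<I> A" "I \<in> \<I>"
  shows "final_set A I \<subseteq> items I"
  using kept_subset_arrived[OF assms order_refl] by (simp add: final_set_def items_def)

lemma OPT_ge:
  assumes "feasible I S"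
  shows "utility I S \<le> OPT I"
proof -
  have "finite {S. feasible I S}"
    by (rule finite_subset[of _ "Pow (items I)"]) (auto simp: feasible_def items_def)
  then show ?thesis unfolding OPT_def using assms by (intro Max_ge) auto
qed


section \<open>Set packing instances\<close>

definition support_weight :: "real \<Rightarrow> 'c::countable set \<Rightarrow> nat \<Rightarrow> real" where
  "support_weight \<epsilon> X i = (if i \<in> to_nat ` X then 1 - \<epsilon> else 0)"

definition set_packing :: "real \<Rightarrow> nat \<Rightarrow> 'c::countable set list \<Rightarrow> ovp" where
  "set_packing \<epsilon> d Xs =
     \<lparr>dim = d, weights = map (support_weight \<epsilon>) Xs, utility = (\<lambda>S. real (card S))\<rparr>"

lemma set_packing_simps [simp]:
  "dim (set_packing \<epsilon> d Xs) = d"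
  "weights (set_packing \<epsilon> d Xs) = map (support_weight \<epsilon>) Xs"
  "utility (set_packing \<epsilon> d Xs) S = real (card S)"
  "items (set_packing \<epsilon> d Xs) = {..<length Xs}"
  by (simp_all add: set_packing_def items_def)

lemma nonneg_monotone_submodular_card:
  assumes "finite U"
  shows "nonneg_monotone_submodular U (\<lambda>S. real (card S))"
proof -
  have "real (card (S \<union> T)) + real (card (S \<inter> T)) \<le> real (card S) + real (card T)"
    if "S \<subseteq> U" "T \<subseteq> U" for S T
    using card_Un_Int[of S T] finite_subset[OF _ assms] that by simp
  moreover have "card S \<le> card T" if "T \<subseteq> U" "S \<subseteq> T" for S T
    using that finite_subset[OF _ assms] by (intro card_mono) auto
  ultimately show ?thesis by (simp add: nonneg_monotone_submodular_def)
qed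

lemma set_packing_in_cardinality_instances:
  fixes Xs :: "'c::countable set list"
  assumes "0 < \<epsilon>" "\<epsilon> < 1" "Xs \<noteq> []"
    and bounded: "\<And>X. X \<in> set Xs \<Longrightarrow> to_nat ` X \<subseteq> {..<d}"
    and card: "\<And>X. X \<in> set Xs \<Longrightarrow> card X = k"
  shows "set_packing \<epsilon> d Xs \<in> cardinality_instances \<epsilon> k"
proof -
  have support: "card {i. i < d \<and> support_weight \<epsilon> X i \<noteq> 0} = k" if "X \<in> set Xs" for X
  proof -
    have "{i. i < d \<and> support_weight \<epsilon> X i \<noteq> 0} = to_nat ` X"
      using bounded[OF that] assms(2) by (auto simp: support_weight_def)
    then show ?thesis using card[OF that] by (simp add: card_image)
  qed
  have "sparsity (set_packing \<epsilon> d Xs) = k"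
    unfolding sparsity_def
  proof (rule Least_equality)
    fix k'
    assume "\<forall>u\<in>items (set_packing \<epsilon> d Xs). card {i. i < dim (set_packing \<epsilon> d Xs) \<and>
      (weights (set_packing \<epsilon> d Xs) ! u) i \<noteq> 0} \<le> k'"
    \<comment> \<open>As the list is nonempty, its first item forces the bound; for an empty list
      the sparsity would be 0.\<close>
    then show "k \<le> k'" using assms(3) support[of "Xs ! 0"] by fastforce
  qed (simp add: support)
  moreover have "nonneg_monotone_submodular {..<length Xs} (utility (set_packing \<epsilon> d Xs))"
    using nonneg_monotone_submodular_card[of "{..<length Xs}"] by (simp add: set_packing_def)
  moreover have "support_weight \<epsilon> (Xs ! u) i = 0" if "u < length Xs" "d \<le> i" for u i
    using bounded[of "Xs ! u"] that by (force simp: support_weight_def)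
  moreover have "support_weight \<epsilon> X i \<in> {0..1 - \<epsilon>}" for X :: "'c set" and i
    using assms(2) by (simp add: support_weight_def)
  ultimately show ?thesis
    by (simp add: cardinality_instances_def ovp_instances_def)
qed

lemma sum_weights_set_packing:
  assumes "S \<subseteq> {..<length Xs}"
  shows "(\<Sum>u\<in>S. (weights (set_packing \<epsilon> d Xs) ! u) i) =
    (1 - \<epsilon>) * real (card {u\<in>S. i \<in> to_nat ` (Xs ! u)})"
proof -
  have fin: "finite S" using assms finite_subset by blast
  have "(\<Sum>u\<in>S. (weights (set_packing \<epsilon> d Xs) ! u) i) =
      (\<Sum>u\<in>S. if i \<in> to_nat ` (Xs ! u) then 1 - \<epsilon> else 0)"
    using assms by (intro sum.cong) (auto simp: support_weight_def)
  also have "\<dots> = (\<Sum>u\<in>{u\<in>S. i \<in> to_nat ` (Xs ! u)}. 1 - \<epsilon>)"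
    using fin by (intro sum.inter_filter[symmetric])
  finally show ?thesis by simp
qed

text \<open>Each coordinate is loaded by at most one item. Only ordered pairs are asked for, since
  the adversaries specify how an item meets earlier ones.\<close>

lemma feasible_set_packingI:
  assumes "0 < \<epsilon>" "\<epsilon> < 1" "S \<subseteq> {..<length Xs}"
    and disj: "\<And>u v. u \<in> S \<Longrightarrow> v \<in> S \<Longrightarrow> u < v \<Longrightarrow> Xs ! u \<inter> Xs ! v = {}"
  shows "feasible (set_packing \<epsilon> d Xs) S"
proof -
  have "(1 - \<epsilon>) * real (card {u\<in>S. i \<in> to_nat ` (Xs ! u)}) \<le> 1" for i
  proof -
    have not_less: "\<not> u < v" if "u \<in> S" "v \<in> S" "i \<in> to_nat ` (Xs ! u)" "i \<in> to_nat ` (Xs ! v)" for u v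
      using disj[OF that(1,2)] that(3,4) by (auto simp: disjoint_iff)
    have "u = v" if "u \<in> S" "v \<in> S" "i \<in> to_nat ` (Xs ! u)" "i \<in> to_nat ` (Xs ! v)" for u v
      using not_less[OF that] not_less[OF that(2,1,4,3)] by simp
    moreover have "finite S" using assms(3) finite_subset by blast
    ultimately have "card {u\<in>S. i \<in> to_nat ` (Xs ! u)} \<le> 1"
      by (simp add: card_le_Suc0_iff_eq)
    then have "real (card {u\<in>S. i \<in> to_nat ` (Xs ! u)}) \<le> 1" by linarith
    then have "(1 - \<epsilon>) * real (card {u\<in>S. i \<in> to_nat ` (Xs ! u)}) \<le> 1 * 1"
      using assms(1,2) by (intro mult_mono) auto
    then show ?thesis by simp
  qed
  then show ?thesis
    unfolding feasible_def using sum_weights_set_packing[OF assms(3)] assms(3) by simp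
qed

text \<open>A shared coordinate would carry load at least \<open>2 * (1 - \<epsilon>) > 1\<close>;
  this is where \<open>\<epsilon> < 1/2\<close> enters.\<close>

lemma feasible_set_packing_disjoint:
  assumes "\<epsilon> < 1/2" and feas: "feasible (set_packing \<epsilon> d Xs) S"
    and bounded: "\<And>X. X \<in> set Xs \<Longrightarrow> to_nat ` X \<subseteq> {..<d}"
    and "u \<in> S" "v \<in> S" "u \<noteq> v"
  shows "Xs ! u \<inter> Xs ! v = {}"
proof (rule ccontr)
  assume "Xs ! u \<inter> Xs ! v \<noteq> {}"
  then obtain c where c: "c \<in> Xs ! u" "c \<in> Xs ! v" by blast
  have S: "S \<subseteq> {..<length Xs}" using feas by (simp add: feasible_def)
  then have "to_nat c < d" using bounded[of "Xs ! u"] c(1) assms(4) by (force simp: subset_iff)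
  then have le: "(1 - \<epsilon>) * real (card {w\<in>S. to_nat c \<in> to_nat ` (Xs ! w)}) \<le> 1"
    using feas sum_weights_set_packing[OF S] by (simp add: feasible_def)
  have "card {u, v} \<le> card {w\<in>S. to_nat c \<in> to_nat ` (Xs ! w)}"
    using c assms(4,5) finite_subset[OF S] by (intro card_mono) auto
  then have "(1 - \<epsilon>) * 2 \<le> (1 - \<epsilon>) * real (card {w\<in>S. to_nat c \<in> to_nat ` (Xs ! w)})"
    using assms(1,6) by (intro mult_left_mono) auto
  with le assms(1) show False by simp
qed

lemma OPT_set_packing_ge:
  assumes "0 < \<epsilon>" "\<epsilon> < 1" "S \<subseteq> {..<length Xs}"
    and "\<And>u v. u \<in> S \<Longrightarrow> v \<in> S \<Longrightarrow> u < v \<Longrightarrow> Xs ! u \<inter> Xs ! v = {}"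
  shows "real (card S) \<le> OPT (set_packing \<epsilon> d Xs)"
  using OPT_ge[OF feasible_set_packingI[OF assms]] by simp

text \<open>Ignorance of the future: at time \<open>t\<close> only the dimension, the first
  \<open>t\<close> vectors and the common utility function are visible.\<close>

lemma kept_set_packing_cong:
  assumes "take t Xs = take t Ys"
  shows "kept A (set_packing \<epsilon> d Xs) t = kept A (set_packing \<epsilon> d Ys) t"
  using assms by (simp add: kept_def take_map set_packing_def)

lemma ex_coordinate_bound:
  fixes C :: "'c::countable set"
  assumes "finite C"
  obtains d where "to_nat ` C \<subseteq> {..<d}"
  using finite_nat_bounded[of "to_nat ` C"] assms by blast


section \<open>Deterministic algorithms\<close>

text \<open>Item \<open>t\<close> meets, among the earlier items, exactly its parent \<open>p\<close>.\<close>

definition tree_item :: "nat \<Rightarrow> nat \<Rightarrow> nat \<Rightarrow> (nat \<times> nat) set" where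
  "tree_item k p t = insert (p, t) ({t} \<times> {1..<k})"

text \<open>
  The parent is the item held by the algorithm; \<open>Sup\<close> extracts it, with \<open>Sup {} = 0\<close> as
  default parent. The intersection with \<open>{..<t}\<close> makes the list a valid instance before
  anything is known about the algorithm.
\<close>

primrec adversary :: "algorithm \<Rightarrow> real \<Rightarrow> nat \<Rightarrow> nat \<Rightarrow> nat \<Rightarrow> (nat \<times> nat) set list" where
  "adversary A \<epsilon> d k 0 = []"
| "adversary A \<epsilon> d k (Suc t) = adversary A \<epsilon> d k t @
     [tree_item k (Sup (kept A (set_packing \<epsilon> d (adversary A \<epsilon> d k t)) t \<inter> {..<t})) t]"

lemma length_adversary [simp]: "length (adversary A \<epsilon> d k t) = t"
  by (induction t) auto

lemma take_adversary: "t \<le> n \<Longrightarrow> take t (adversary A \<epsilon> d k n) = adversary A \<epsilon> d k t"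
  by (induction n rule: nat_induct) (auto simp: le_Suc_eq)

text \<open>The recursion consults the algorithm on a prefix; by ignorance of the future, the parent
  can be read off the run on the whole instance.\<close>

lemma nth_adversary:
  assumes "t < n"
  shows "adversary A \<epsilon> d k n ! t =
    tree_item k (Sup (kept A (set_packing \<epsilon> d (adversary A \<epsilon> d k n)) t \<inter> {..<t})) t"
proof -
  have "adversary A \<epsilon> d k n ! t = adversary A \<epsilon> d k (Suc t) ! t"
    using take_adversary[of "Suc t" n A \<epsilon> d k] assms by (metis lessI nth_take Suc_leI)
  also have "\<dots> = tree_item k (Sup (kept A (set_packing \<epsilon> d (adversary A \<epsilon> d k t)) t \<inter> {..<t})) t"
    by (simp add: nth_append)
  also have "kept A (set_packing \<epsilon> d (adversary A \<epsilon> d k t)) t =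
      kept A (set_packing \<epsilon> d (adversary A \<epsilon> d k n)) t"
    using assms by (intro kept_set_packing_cong) (simp add: take_adversary)
  finally show ?thesis .
qed

text \<open>Vertices are coloured in increasing order, each opposite to its parent, which has a
  smaller index.\<close>

lemma ex_tree_coloring:
  fixes p :: "nat \<Rightarrow> nat"
  assumes "\<And>t. 0 < t \<Longrightarrow> t < n \<Longrightarrow> p t < t"
  shows "\<exists>c :: nat \<Rightarrow> bool. \<forall>t. 0 < t \<and> t < n \<longrightarrow> c t \<noteq> c (p t)"
  using assms
proof (induction n)
  case (Suc n)
  then obtain c :: "nat \<Rightarrow> bool" where c: "\<forall>t. 0 < t \<and> t < n \<longrightarrow> c t \<noteq> c (p t)"
    by (auto simp: less_Suc_eq)
  have "(c(n := \<not> c (p n))) t \<noteq> (c(n := \<not> c (p n))) (p t)" if "0 < t" "t < Suc n" for t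
    using c Suc.prems[OF that] that by (cases "t = n") auto
  then show ?case by blast
qed simp

text \<open>The larger class of a proper 2-colouring contains at least half of the vertices and no
  edge.\<close>

lemma ex_large_independent_in_tree:
  fixes p :: "nat \<Rightarrow> nat"
  assumes "\<And>t. 0 < t \<Longrightarrow> t < n \<Longrightarrow> p t < t"
  obtains S where "S \<subseteq> {..<n}" "real n / 2 \<le> real (card S)"
    "\<And>s t. s \<in> S \<Longrightarrow> t \<in> S \<Longrightarrow> s < t \<Longrightarrow> p t \<noteq> s"
proof -
  obtain c :: "nat \<Rightarrow> bool" where c: "\<And>t. 0 < t \<Longrightarrow> t < n \<Longrightarrow> c t \<noteq> c (p t)"
    using ex_tree_coloring[of n p] assms by auto
  have "{..<n} = {t. t < n \<and> c t} \<union> {t. t < n \<and> \<not> c t}" by auto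
  then have "n = card ({t. t < n \<and> c t} \<union> {t. t < n \<and> \<not> c t})"
    by (metis card_lessThan)
  also have "\<dots> = card {t. t < n \<and> c t} + card {t. t < n \<and> \<not> c t}"
    by (intro card_Un_disjoint) auto
  finally consider "real n / 2 \<le> real (card {t. t < n \<and> c t})"
    | "real n / 2 \<le> real (card {t. t < n \<and> \<not> c t})" by linarith
  then show ?thesis
  proof cases
    case 1
    show ?thesis by (rule that[OF _ 1]) (use c in fastforce)+
  next
    case 2
    show ?thesis by (rule that[OF _ 2]) (use c in fastforce)+
  qed
qed

lemma deterministic_lower_bound:
  assumes \<epsilon>: "0 < \<epsilon>" "\<epsilon> < 1/2" and "1 \<le> k"
    and sub: "cardinality_instances \<epsilon> k \<subseteq> \<I>" and on: "online_algorithm \<I> A"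
  shows "ereal (1 / 2 * real k) \<le> competitive_ratio \<I> (ALG A)"
proof -
  obtain d where d: "to_nat ` ({..<k} \<times> {..<k}) \<subseteq> {..<d}"
    using ex_coordinate_bound[of "{..<k} \<times> {..<k}"] by auto
  \<comment> \<open>Item \<open>p\<close> offers \<open>(p, 1)\<close>, ...,
    \<open>(p, k - 1)\<close>, one coordinate per possible child, so supports of size
    \<open>k\<close> sustain \<open>k\<close> items.\<close>
  define Xs where "Xs = adversary A \<epsilon> d k k"
  define I where "I = set_packing \<epsilon> d Xs"
  define p where "p t = Sup (kept A I t \<inter> {..<t})" for t
  have len: "length Xs = k" by (simp add: Xs_def)
  have nth: "Xs ! t = tree_item k (p t) t" if "t < k" for t
    using nth_adversary[OF that] by (simp add: Xs_def p_def I_def)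
  \<comment> \<open>Item 0 is its own default parent; \<open>(0, 0)\<close> pads its support to size
    \<open>k\<close> and occurs in no other item.\<close>
  have p0: "p 0 = 0" by (simp add: p_def)
  have p_less: "p t < t" if "0 < t" for t
  proof (cases "kept A I t \<inter> {..<t} = {}")
    case False
    then show ?thesis
      using Max_in[of "kept A I t \<inter> {..<t}"] by (simp add: p_def cSup_eq_Max)
  qed (use that in \<open>simp add: p_def\<close>)
  have p_le: "p t \<le> t" for t using p0 p_less[of t] by (cases "t = 0") auto
  have X: "X \<subseteq> {..<k} \<times> {..<k} \<and> card X = k" if X: "X \<in> set Xs" for X
  proof -
    obtain t where t: "t < k" "X = tree_item k (p t) t"
      using X nth by (auto simp: Xs_def in_set_conv_nth)
    have "(p t, t) \<notin> {t} \<times> {1..<k}" using p0 p_less[of t] by (cases "t = 0") auto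
    moreover have "card ({t} \<times> {1..<k}) = k - 1" by (simp add: card_cartesian_product)
    ultimately have "card X = k" using t \<open>1 \<le> k\<close> by (simp add: tree_item_def)
    then show ?thesis using t p_le[of t] by (auto simp: tree_item_def)
  qed
  have bounded: "to_nat ` X \<subseteq> {..<d}" if "X \<in> set Xs" for X
    using X[OF that] d by blast
  have "I \<in> cardinality_instances \<epsilon> k"
    unfolding I_def using \<epsilon> \<open>1 \<le> k\<close> len X bounded
    by (intro set_packing_in_cardinality_instances) auto
  with sub have I: "I \<in> \<I>" by blast
  have len_I: "length (weights I) = k" by (simp add: I_def len)
  \<comment> \<open>If at most \<open>p t\<close> is held when item \<open>t\<close> arrives, the
    conflict leaves at most one of the two, and a survivor is by definition
    \<open>p (Suc t)\<close>. For \<open>t = 0\<close> both coincide.\<close>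
  have holds_one: "kept A I t \<subseteq> {p t}" if "t \<le> k" for t
    using that
  proof (induction t)
    case 0
    then show ?case using on I by (simp add: online_algorithm_def)
  next
    case (Suc t)
    have "kept A I (Suc t) \<subseteq> insert t (kept A I t)"
      using on I Suc.prems len_I by (simp add: online_algorithm_def)
    with Suc have sub': "kept A I (Suc t) \<subseteq> {p t, t}" by auto
    have "\<not> (p t \<in> kept A I (Suc t) \<and> t \<in> kept A I (Suc t) \<and> p t \<noteq> t)"
    proof
      assume *: "p t \<in> kept A I (Suc t) \<and> t \<in> kept A I (Suc t) \<and> p t \<noteq> t"
      have "feasible (set_packing \<epsilon> d Xs) (kept A I (Suc t))"
        using feasible_kept[OF on I] Suc len_I by (simp add: I_def)
      then have "Xs ! p t \<inter> Xs ! t = {}"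
        using * \<epsilon> bounded by (intro feasible_set_packing_disjoint) auto
      moreover have "p t < t" using * p0 p_less by (cases "t = 0") auto
      ultimately show False using Suc.prems by (auto simp: nth tree_item_def)
    qed
    with sub' obtain x where x: "kept A I (Suc t) \<subseteq> {x}" "x \<in> {p t, t}" by blast
    show ?case
    proof (cases "kept A I (Suc t) = {}")
      case False
      with x(1) have "kept A I (Suc t) = {x}" by blast
      moreover have "x < Suc t" using x(2) p_le[of t] by auto
      ultimately show ?thesis by (simp add: p_def)
    qed simp
  qed
  have "card (final_set A I) \<le> 1"
    using holds_one[OF order_refl] len_I card_mono[of "{p k}" "final_set A I"]
    by (simp add: final_set_def)
  then have alg: "ALG A I \<le> 1" by (simp add: ALG_def I_def)
  obtain S where S: "S \<subseteq> {..<k}" "real k / 2 \<le> real (card S)"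
    "\<And>s t. s \<in> S \<Longrightarrow> t \<in> S \<Longrightarrow> s < t \<Longrightarrow> p t \<noteq> s"
    using ex_large_independent_in_tree[of k p] p_less by blast
  \<comment> \<open>A common coordinate would require \<open>p t = s\<close> or
    \<open>p s = t\<close>; the latter fails because \<open>p s \<le> s < t\<close>.\<close>
  have "Xs ! s \<inter> Xs ! t = {}" if "s \<in> S" "t \<in> S" "s < t" for s t
  proof -
    have "s < k" "t < k" "p t \<noteq> s" "p s \<le> s" using S that p_le by auto
    then show ?thesis using \<open>s < t\<close> by (auto simp: nth tree_item_def)
  qed
  then have "real (card S) \<le> OPT I"
    unfolding I_def using \<epsilon> S(1) len by (intro OPT_set_packing_ge) auto
  then have "ereal (real k / 2 / 1) \<le> competitive_ratio \<I> (ALG A)"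
    using I alg S(2) \<open>1 \<le> k\<close>
    by (intro competitive_ratio_ge[where I = I]) (auto simp: ALG_def I_def)
  then show ?thesis by simp
qed


section \<open>Randomized algorithms\<close>

text \<open>
  Items arrive in \<open>T\<close> batches of \<open>2 ^ L\<close> items each; \<open>g s\<close> is the secret good item of batch \<open>s\<close>.
  The coordinate \<open>(s, t, j, b)\<close> with \<open>s < t\<close> is used by the items of batch \<open>s\<close> whose \<open>j\<close>-th bit is
  \<open>b\<close>, and by all items of batch \<open>t\<close> if the \<open>j\<close>-th bit of \<open>g s\<close> is not \<open>b\<close>. So the items of batch
  \<open>t\<close> conflict exactly with the bad items of earlier batches. The coordinates \<open>(s, s, i, b)\<close> make
  the items of a batch conflict with each other and pad the support to size \<open>k\<close>.
\<close>

definition batch_item ::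
  "nat \<Rightarrow> nat \<Rightarrow> nat \<Rightarrow> (nat \<Rightarrow> nat) \<Rightarrow> nat \<Rightarrow> nat \<Rightarrow> (nat \<times> nat \<times> nat \<times> bool) set" where
  "batch_item k T L g s x =
     (\<lambda>(t, j). (s, t, j, bit x j)) ` ({s<..<T} \<times> {..<L}) \<union>
     (\<lambda>(t, j). (t, s, j, \<not> bit (g t) j)) ` ({..<s} \<times> {..<L}) \<union>
     (\<lambda>i. (s, s, i, False)) ` {..<k - (T - 1) * L}"

definition batches :: "nat \<Rightarrow> nat \<Rightarrow> nat \<Rightarrow> (nat \<Rightarrow> nat) \<Rightarrow> (nat \<times> nat \<times> nat \<times> bool) set list" where
  "batches k T L g = map (\<lambda>u. batch_item k T L g (u div 2 ^ L) (u mod 2 ^ L)) [0..<T * 2 ^ L]"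

lemma length_batches [simp]: "length (batches k T L g) = T * 2 ^ L"
  by (simp add: batches_def)

section \<open>Conflict structure of the batches\<close>

lemma nth_batches:
  "u < T * 2 ^ L \<Longrightarrow> batches k T L g ! u = batch_item k T L g (u div 2 ^ L) (u mod 2 ^ L)"
  by (simp add: batches_def)

lemma batch_index:
  fixes m :: nat
  assumes "s < T" "x < m"
  shows "s * m + x < T * m" "(s * m + x) div m = s" "(s * m + x) mod m = x"
proof -
  have "s * m + x < Suc s * m" using assms(2) by simp
  also have "\<dots> \<le> T * m" using assms(1) by (intro mult_le_mono1) auto
  finally show "s * m + x < T * m" .
qed (use assms(2) in auto)

lemma mem_batch_item_iff:
  "(a, b, j, c) \<in> batch_item k T L g s x \<longleftrightarrow>
     a = s \<and> s < b \<and> b < T \<and> j < L \<and> c = bit x j \<or>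
     b = s \<and> a < s \<and> j < L \<and> c = (\<not> bit (g a) j) \<or>
     a = s \<and> b = s \<and> j < k - (T - 1) * L \<and> \<not> c"
  unfolding batch_item_def by (auto simp: image_iff)

lemma batch_item_subset:
  assumes "s < T"
  shows "batch_item k T L g s x \<subseteq> {..<T} \<times> {..<T} \<times> {..<k + L} \<times> UNIV"
  using assms by (auto simp: batch_item_def)

text \<open>An item has \<open>L\<close> coordinates for each of the \<open>T - 1\<close> other
  batches, earlier or later, and the padding supplies the rest.\<close>

lemma card_batch_item:
  assumes "s < T" "(T - 1) * L \<le> k"
  shows "card (batch_item k T L g s x) = k"
proof -
  have "card (batch_item k T L g s x) =
      card ((\<lambda>(t, j). (s, t, j, bit x j)) ` ({s<..<T} \<times> {..<L})) +
      card ((\<lambda>(t, j). (t, s, j, \<not> bit (g t) j)) ` ({..<s} \<times> {..<L})) +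
      card ((\<lambda>i. (s, s, i, False)) ` {..<k - (T - 1) * L})"
    unfolding batch_item_def
    by (subst card_Un_disjoint; (subst card_Un_disjoint)?) auto
  also have "\<dots> = (T - Suc s) * L + s * L + (k - (T - 1) * L)"
    by (subst card_image, force simp: inj_on_def)+ (simp add: card_cartesian_product)
  also have "(T - Suc s) * L + s * L = (T - 1) * L"
    using assms(1) by (simp flip: add_mult_distrib)
  finally show ?thesis using assms(2) by simp
qed

text \<open>The strict inequality leaves at least one padding coordinate, common to the whole
  batch.\<close>

lemma batch_items_conflict_same_batch:
  assumes "(T - 1) * L < k"
  shows "batch_item k T L g s x \<inter> batch_item k T L g s y \<noteq> {}"
proof -
  have "(s, s, 0, False) \<in> batch_item k T L g s x" for x
    using assms by (auto simp: batch_item_def)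
  then show ?thesis by blast
qed

text \<open>At a bit \<open>j\<close> where \<open>x\<close> and \<open>g s\<close> differ, the bit
  of \<open>x\<close> is the negated bit of \<open>g s\<close>, which every item of batch
  \<open>t\<close> uses.\<close>

lemma bad_item_conflicts_later_batch:
  assumes "s < t" "t < T" "x < 2 ^ L" "g s < 2 ^ L" "x \<noteq> g s"
  shows "batch_item k T L g s x \<inter> batch_item k T L g t y \<noteq> {}"
proof -
  obtain j where j: "bit x j \<noteq> bit (g s) j" using assms(5) by (auto simp: bit_eq_iff)
  \<comment> \<open>Both numbers are below \<open>2 ^ L\<close>, so they can differ only in the
    first \<open>L\<close> bits.\<close>
  have "\<not> bit a j" if "L \<le> j" "a < 2 ^ L" for a :: nat
    using that by (metis bit_take_bit_iff not_le take_bit_nat_eq_self)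
  with j assms(3,4) have "j < L" by (meson not_le)
  with assms j have "(s, t, j, bit x j) \<in> batch_item k T L g s x \<inter> batch_item k T L g t y"
    by (auto simp: mem_batch_item_iff)
  then show ?thesis by blast
qed

lemma good_item_disjoint_later_batch:
  assumes "s < t"
  shows "batch_item k T L g s (g s) \<inter> batch_item k T L g t y = {}"
  using assms by (auto simp: disjoint_iff mem_batch_item_iff)

text \<open>Batch \<open>s\<close> depends only on the secrets of earlier batches, so
  \<open>g s\<close> is still undisclosed when batch \<open>s\<close> has completely
  arrived.\<close>

lemma take_batches_cong:
  assumes "\<And>t. t < s \<Longrightarrow> g t = h t" "s < T"
  shows "take (Suc s * 2 ^ L) (batches k T L g) = take (Suc s * 2 ^ L) (batches k T L h)"
proof (rule nth_equalityI)
  fix u assume "u < length (take (Suc s * 2 ^ L) (batches k T L g))"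
  then have u: "u < Suc s * 2 ^ L" "u < T * 2 ^ L" by auto
  then have "u div 2 ^ L \<le> s" by (simp add: less_mult_imp_div_less flip: less_Suc_eq_le)
  then have "batch_item k T L g (u div 2 ^ L) x = batch_item k T L h (u div 2 ^ L) x" for x
    using assms(1) by (auto simp: set_eq_iff mem_batch_item_iff)
  then show "take (Suc s * 2 ^ L) (batches k T L g) ! u = take (Suc s * 2 ^ L) (batches k T L h) ! u"
    using u by (simp add: nth_batches)
qed simp

text \<open>
  \<open>Y g\<close> is the set of guesses for \<open>g s\<close>. Resampling \<open>g s\<close> embeds the product of the correctly guessed
  \<open>g\<close> and \<open>{..<m}\<close> into \<open>G\<close>.
\<close>

lemma card_correct_guesses:
  fixes Y :: "(nat \<Rightarrow> nat) \<Rightarrow> nat set"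
  assumes "s < T"
    and G: "G = PiE {..<T} (\<lambda>_. {..<m})"
    and indep: "\<And>g v. Y (g(s := v)) = Y g"
    and single: "\<And>g x y. g \<in> G \<Longrightarrow> x \<in> Y g \<Longrightarrow> y \<in> Y g \<Longrightarrow> x < m \<Longrightarrow> y < m \<Longrightarrow> x = y"
  shows "m * card {g\<in>G. g s \<in> Y g} \<le> card G"
proof -
  have fin: "finite G" by (simp add: G finite_PiE)
  have "inj_on (\<lambda>(g, v). g(s := v)) ({g\<in>G. g s \<in> Y g} \<times> {..<m})"
  proof (intro inj_onI, clarsimp)
    fix g v h w
    assume *: "g \<in> G" "g s \<in> Y g" "h \<in> G" "h s \<in> Y h" "g(s := v) = h(s := w)"
    \<comment> \<open>\<open>Y\<close> ignores the overwritten value, so the common image determines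
      the guess set, whose only element below \<open>m\<close> is that value.\<close>
    have "Y g = Y h" using indep[of g v] indep[of h w] *(5) by simp
    moreover have "g s < m" "h s < m" using *(1,3) assms(1) by (auto simp: G)
    ultimately have "g s = h s" using single[of g "g s" "h s"] * by simp
    then show "g = h \<and> v = w" using *(5) by (metis fun_upd_same fun_upd_triv fun_upd_upd)
  qed
  moreover have "(\<lambda>(g, v). g(s := v)) ` ({g\<in>G. g s \<in> Y g} \<times> {..<m}) \<subseteq> G"
    using assms(1) by (auto simp: G PiE_iff extensional_def split: if_splits)
  ultimately have "card ({g\<in>G. g s \<in> Y g} \<times> {..<m}) \<le> card G"
    using fin by (rule card_inj_on_le)
  then show ?thesis by (simp add: card_cartesian_product mult.commute)
qed

text \<open>Any two bad items conflict, within a batch or across batches, so at most one is kept;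
  this gives the summand 1. The sum counts the correct guesses.\<close>

lemma ALG_batches_le:
  fixes k T L :: nat
  defines "m \<equiv> 2 ^ L"
  assumes \<epsilon>: "\<epsilon> < 1/2" and TL: "(T - 1) * L < k"
    and bounded: "\<And>X. X \<in> set (batches k T L g) \<Longrightarrow> to_nat ` X \<subseteq> {..<d}"
    and g: "\<And>s. s < T \<Longrightarrow> g s < m"
    and on: "online_algorithm \<I> A" and I: "I \<in> \<I>" and I_def: "I = set_packing \<epsilon> d (batches k T L g)"
  shows "ALG A I \<le> 1 + (\<Sum>s<T. of_bool (s * m + g s \<in> kept A I (Suc s * m)))"
proof -
  define F where "F = final_set A I"
  have len: "length (weights I) = T * m" by (simp add: I_def m_def)
  have F: "F \<subseteq> {..<T * m}"
    using kept_subset_arrived[OF on I order_refl] by (simp add: F_def final_set_def len)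
  have disj: "batch_item k T L g (u div m) (u mod m) \<inter> batch_item k T L g (v div m) (v mod m) = {}"
    if "u \<in> F" "v \<in> F" "u \<noteq> v" for u v
  proof -
    have "feasible (set_packing \<epsilon> d (batches k T L g)) F"
      using feasible_kept[OF on I order_refl] by (simp add: F_def final_set_def I_def)
    then have "batches k T L g ! u \<inter> batches k T L g ! v = {}"
      using \<epsilon> bounded that by (intro feasible_set_packing_disjoint) auto
    moreover have "u < T * 2 ^ L" "v < T * 2 ^ L" using F that by (auto simp: m_def)
    ultimately show ?thesis by (simp add: nth_batches m_def)
  qed
  define bad where "bad = {u\<in>F. u mod m \<noteq> g (u div m)}"
  define good where "good = {s. s < T \<and> s * m + g s \<in> F}"
  have not_less: "\<not> u < v" if "u \<in> bad" "v \<in> bad" for u v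
  proof
    assume "u < v"
    have uv: "u \<in> F" "v \<in> F" "v div m < T" "u mod m \<noteq> g (u div m)"
      using that F by (auto simp: bad_def less_mult_imp_div_less)
    have le: "u div m \<le> v div m" using \<open>u < v\<close> by (intro div_le_mono) auto
    have "batch_item k T L g (u div m) (u mod m) \<inter> batch_item k T L g (v div m) (v mod m) \<noteq> {}"
    proof (cases "u div m = v div m")
      case True
      then show ?thesis using batch_items_conflict_same_batch[OF TL] by simp
    next
      case False
      then show ?thesis
        using le uv g[of "u div m"] by (intro bad_item_conflicts_later_batch) (auto simp: m_def)
    qed
    then show False using disj[of u v] uv \<open>u < v\<close> by simp
  qed
  have "finite F" using F finite_subset by blast
  then have fin: "finite bad" "finite good"
    by (simp_all add: bad_def good_def)
  have "\<forall>u\<in>bad. \<forall>v\<in>bad. u = v" using not_less by (meson linorder_neqE_nat)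
  with fin have "card bad \<le> 1" by (simp add: card_le_Suc0_iff_eq)
  moreover have "F \<subseteq> bad \<union> (\<lambda>s. s * m + g s) ` good"
  proof
    fix u assume u: "u \<in> F"
    show "u \<in> bad \<union> (\<lambda>s. s * m + g s) ` good"
    proof (cases "u mod m = g (u div m)")
      case True
      then have "u = u div m * m + g (u div m)" by (metis div_mult_mod_eq)
      moreover have "u div m < T" using u F by (auto simp: less_mult_imp_div_less)
      ultimately show ?thesis using u by (auto simp: good_def)
    qed (use u in \<open>simp add: bad_def\<close>)
  qed
  then have "card F \<le> card (bad \<union> (\<lambda>s. s * m + g s) ` good)"
    using fin by (intro card_mono) auto
  moreover have "\<dots> \<le> card bad + card ((\<lambda>s. s * m + g s) ` good)" by (rule card_Un_le)
  moreover have "card ((\<lambda>s. s * m + g s) ` good) \<le> card good" using fin by (intro card_image_le)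
  ultimately have "card F \<le> 1 + card good" by linarith
  moreover have "card good \<le> card {s. s < T \<and> s * m + g s \<in> kept A I (Suc s * m)}"
  proof (intro card_mono subsetI)
    fix s assume "s \<in> good"
    then have s: "s < T" "s * m + g s \<in> F" by (auto simp: good_def)
    have "Suc s * m \<le> T * m" using s(1) by (intro mult_le_mono1) auto
    then have "kept A I (T * m) \<inter> {..<Suc s * m} \<subseteq> kept A I (Suc s * m)"
      using kept_Int_arrived_subset[OF on I, of "Suc s * m" "T * m"] len by simp
    moreover have "s * m + g s < Suc s * m" using g[OF s(1)] by simp
    ultimately show "s \<in> {s. s < T \<and> s * m + g s \<in> kept A I (Suc s * m)}"
      using s by (auto simp: F_def final_set_def len)
  qed simp
  moreover have "(\<Sum>s<T. of_bool (s * m + g s \<in> kept A I (Suc s * m))) =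
      real (card {s. s < T \<and> s * m + g s \<in> kept A I (Suc s * m)})"
    by (subst sum_of_bool_eq) (auto intro!: arg_cong[where f = card])
  moreover have "ALG A I = real (card F)" by (simp add: ALG_def F_def I_def)
  ultimately show ?thesis by linarith
qed

text \<open>For a fixed deterministic algorithm and uniform secrets, each of the \<open>T\<close>
  good items is held at the end of its batch with probability at most \<open>1 / m\<close>: at most
  one item of the batch is held, chosen independently of \<open>g s\<close>.\<close>

lemma sum_ALG_batches_le:
  fixes k T L :: nat
  defines "m \<equiv> 2 ^ L"
  assumes \<epsilon>: "\<epsilon> < 1/2" and TL: "(T - 1) * L < k"
    and G: "G = PiE {..<T} (\<lambda>_. {..<m})"
    and bounded: "\<And>g X. X \<in> set (batches k T L g) \<Longrightarrow> to_nat ` X \<subseteq> {..<d}"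
    and on: "online_algorithm \<I> A"
    and I_def: "\<And>g. I g = set_packing \<epsilon> d (batches k T L g)"
    and I: "\<And>g. I g \<in> \<I>"
  shows "(\<Sum>g\<in>G. ALG A (I g)) \<le> (1 + real T / real m) * real (card G)"
proof -
  have "m > 0" by (simp add: m_def)
  have fin: "finite G" by (simp add: G finite_PiE)
  have len: "length (weights (I g)) = T * m" for g by (simp add: I_def m_def)
  define Y where "Y s g = {x. s * m + x \<in> kept A (I g) (Suc s * m)}" for s g
  have guesses: "real (card {g\<in>G. g s \<in> Y s g}) \<le> real (card G) / real m" if "s < T" for s
  proof -
    have Suc_le: "Suc s * m \<le> T * m" using that by (intro mult_le_mono1) auto
    have "m * card {g\<in>G. g s \<in> Y s g} \<le> card G"
    proof (rule card_correct_guesses[OF that G])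
      fix g v
      have "kept A (I (g(s := v))) (Suc s * m) = kept A (I g) (Suc s * m)"
        unfolding I_def m_def using that by (intro kept_set_packing_cong take_batches_cong) auto
      then show "Y s (g(s := v)) = Y s g" by (simp add: Y_def)
    next
      fix g x y assume *: "x \<in> Y s g" "y \<in> Y s g" "x < m" "y < m"
      show "x = y"
      proof (rule ccontr)
        assume "x \<noteq> y"
        have "feasible (set_packing \<epsilon> d (batches k T L g)) (kept A (I g) (Suc s * m))"
          using feasible_kept[OF on I, of "Suc s * m" g] Suc_le unfolding len by (simp only: I_def)
        then have "batches k T L g ! (s * m + x) \<inter> batches k T L g ! (s * m + y) = {}"
          using \<epsilon> bounded * \<open>x \<noteq> y\<close> by (intro feasible_set_packing_disjoint) (auto simp: Y_def)
        then show False
          using batch_items_conflict_same_batch[OF TL] batch_index[OF that] *(3,4)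
          by (simp add: nth_batches m_def)
      qed
    qed
    then have "real (m * card {g\<in>G. g s \<in> Y s g}) \<le> real (card G)" by (simp only: of_nat_le_iff)
    then show ?thesis using \<open>m > 0\<close> by (simp add: field_simps)
  qed
  have "(\<Sum>g\<in>G. ALG A (I g)) \<le> (\<Sum>g\<in>G. 1 + (\<Sum>s<T. of_bool (g s \<in> Y s g)))"
  proof (rule sum_mono)
    fix g assume "g \<in> G"
    then have "g s < 2 ^ L" if "s < T" for s using that by (auto simp: G m_def)
    from ALG_batches_le[OF \<epsilon> TL bounded this on I I_def]
    show "ALG A (I g) \<le> 1 + (\<Sum>s<T. of_bool (g s \<in> Y s g))" by (simp add: Y_def m_def)
  qed
  also have "\<dots> = real (card G) + (\<Sum>s<T. \<Sum>g\<in>G. of_bool (g s \<in> Y s g))"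
    by (subst sum.swap) (simp add: sum.distrib)
  also have "\<dots> = real (card G) + (\<Sum>s<T. real (card {g\<in>G. g s \<in> Y s g}))"
    using fin by (simp add: sum_of_bool_eq Int_def)
  also have "\<dots> \<le> real (card G) + (\<Sum>s<T. real (card G) / real m)"
    using guesses by (intro add_mono sum_mono) auto
  also have "\<dots> = (1 + real T / real m) * real (card G)" by (simp add: algebra_simps)
  finally show ?thesis .
qed

text \<open>Yao's principle: averaging over secrets gives one secret with expected utility at most
  2, whereas the \<open>T\<close> good items are compatible.\<close>

lemma randomized_lower_bound_batches:
  fixes k T L :: nat
  assumes \<epsilon>: "0 < \<epsilon>" "\<epsilon> < 1/2" and TL: "(T - 1) * L < k" and T: "0 < T" "T \<le> 2 ^ L"
    and sub: "cardinality_instances \<epsilon> k \<subseteq> \<I>" and rand: "randomized_online_algorithm \<I> M"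
  shows "ereal (real T / 2) \<le> competitive_ratio \<I> (expected_ALG M)"
proof -
  interpret prob_space M using rand by (simp add: randomized_online_algorithm_def)
  have on: "online_algorithm \<I> A" if "A \<in> space M" for A
    using rand that by (simp add: randomized_online_algorithm_def)
  define m :: nat where "m = 2 ^ L"
  define G where "G = PiE {..<T} (\<lambda>_. {..<m})"
  \<comment> \<open>One dimension serves all secrets, so it reveals nothing about
    \<open>g\<close>.\<close>
  obtain d where d: "to_nat ` ({..<T} \<times> {..<T} \<times> {..<k + L} \<times> (UNIV :: bool set)) \<subseteq> {..<d}"
    using ex_coordinate_bound[of "{..<T} \<times> {..<T} \<times> {..<k + L} \<times> (UNIV :: bool set)"] by auto
  define I where "I g = set_packing \<epsilon> d (batches k T L g)" for g
  have X: "X \<subseteq> {..<T} \<times> {..<T} \<times> {..<k + L} \<times> UNIV \<and> card X = k"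
    if X: "X \<in> set (batches k T L g)" for X g
  proof -
    obtain u where u: "u < T * 2 ^ L" "X = batch_item k T L g (u div 2 ^ L) (u mod 2 ^ L)"
      using X by (auto simp: batches_def)
    have "u div 2 ^ L < T" using u(1) by (simp add: less_mult_imp_div_less)
    then show ?thesis using batch_item_subset card_batch_item TL u(2) by (metis less_imp_le)
  qed
  have bounded: "to_nat ` X \<subseteq> {..<d}" if "X \<in> set (batches k T L g)" for X g
    using X[OF that] d by blast
  have "I g \<in> cardinality_instances \<epsilon> k" for g
  proof -
    have "length (batches k T L g) \<noteq> 0" using T by simp
    then have "batches k T L g \<noteq> []" by (metis list.size(3))
    then show ?thesis
      unfolding I_def using \<epsilon> X bounded by (intro set_packing_in_cardinality_instances) auto
  qed
  with sub have I: "I g \<in> \<I>" for g by blast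
  have G: "finite G" "G \<noteq> {}" by (auto simp: G_def m_def finite_PiE PiE_eq_empty_iff lessThan_empty_iff)
  \<comment> \<open>Utility is bounded by the number of items; integrability permits exchanging the
    sum over secrets with the expectation.\<close>
  have integrable: "integrable M (\<lambda>A. ALG A (I g))" for g
  proof (rule integrable_const_bound)
    have "norm (ALG A (I g)) \<le> real (T * 2 ^ L)" if "A \<in> space M" for A
    proof -
      have "card (final_set A (I g)) \<le> card (items (I g))"
        using final_set_subset_items[OF on[OF that] I] by (intro card_mono) (auto simp: I_def)
      then have "real (card (final_set A (I g))) \<le> real (T * 2 ^ L)"
        unfolding of_nat_le_iff by (simp add: I_def)
      then show ?thesis by (simp add: ALG_def I_def)
    qed
    then show "AE A in M. norm (ALG A (I g)) \<le> real (T * 2 ^ L)" by simp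
    have "(\<lambda>A. final_set A (I g)) \<in> measurable M (count_space UNIV)"
      using rand I by (simp add: randomized_online_algorithm_def)
    then show "(\<lambda>A. ALG A (I g)) \<in> borel_measurable M"
      unfolding ALG_def by (rule measurable_compose) simp
  qed
  have "(\<Sum>g\<in>G. expected_ALG M (I g)) = (LINT A|M. (\<Sum>g\<in>G. ALG A (I g)))"
    unfolding expected_ALG_def using integrable by (intro Bochner_Integration.integral_sum[symmetric])
  also have "\<dots> \<le> (LINT A|M. 2 * real (card G))"
  proof (rule integral_mono)
    fix A assume "A \<in> space M"
    have "(\<Sum>g\<in>G. ALG A (I g)) \<le> (1 + real T / real m) * real (card G)"
      unfolding m_def using \<epsilon> TL bounded on[OF \<open>A \<in> space M\<close>] I
      by (intro sum_ALG_batches_le[of \<epsilon> T L k]) (auto simp: G_def m_def I_def)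
    also have "\<dots> \<le> 2 * real (card G)"
    proof (rule mult_right_mono)
      have "real T \<le> real m" using T(2) unfolding m_def of_nat_le_iff .
      then show "1 + real T / real m \<le> 2" using T(1) by (simp add: field_simps)
    qed simp
    finally show "(\<Sum>g\<in>G. ALG A (I g)) \<le> 2 * real (card G)" .
  qed (use integrable in auto)
  also have "\<dots> = (\<Sum>g\<in>G. 2)" by (simp add: prob_space)
  \<comment> \<open>If every secret gave more than 2, the sum over the nonempty \<open>G\<close>
    would exceed \<open>2 * card G\<close>.\<close>
  finally obtain g where g: "g \<in> G" "expected_ALG M (I g) \<le> 2"
    using sum_strict_mono[OF G, of "\<lambda>_. 2" "\<lambda>g. expected_ALG M (I g)"] by (meson not_le)
  have g_less: "g s < 2 ^ L" if "s < T" for s using g(1) that by (auto simp: G_def m_def)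
  have "real (card ((\<lambda>s. s * 2 ^ L + g s) ` {..<T})) \<le> OPT (I g)"
    unfolding I_def
  proof (rule OPT_set_packing_ge)
    show "(\<lambda>s. s * 2 ^ L + g s) ` {..<T} \<subseteq> {..<length (batches k T L g)}"
      using batch_index(1) g_less by auto
    fix u v
    assume uv: "u \<in> (\<lambda>s. s * 2 ^ L + g s) ` {..<T}" "v \<in> (\<lambda>s. s * 2 ^ L + g s) ` {..<T}" "u < v"
    then obtain s t where st: "s < T" "u = s * 2 ^ L + g s" "t < T" "v = t * 2 ^ L + g t" by auto
    note s = batch_index[OF st(1) g_less[OF st(1)]] and t = batch_index[OF st(3) g_less[OF st(3)]]
    have "s \<le> t" using div_le_mono[of u v "2 ^ L"] uv(3) s(2) t(2) st by simp
    then have "s < t" using uv(3) st by (cases "s = t") auto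
    then show "batches k T L g ! u \<inter> batches k T L g ! v = {}"
      using good_item_disjoint_later_batch s t st by (simp add: nth_batches)
  qed (use \<epsilon> in auto)
  moreover have "inj_on (\<lambda>s. s * 2 ^ L + g s) {..<T}"
    by (rule inj_on_inverseI[where g = "\<lambda>u. u div 2 ^ L"]) (use batch_index(2) g_less in auto)
  ultimately have "real T \<le> OPT (I g)" by (simp add: card_image)
  moreover have "0 \<le> expected_ALG M (I g)"
    unfolding expected_ALG_def by (rule Bochner_Integration.integral_nonneg) (simp add: ALG_def I_def)
  ultimately show ?thesis using g(2) T(1) I by (intro competitive_ratio_ge[where I = "I g"]) auto
qed

lemma randomized_lower_bound:
  assumes \<epsilon>: "0 < \<epsilon>" "\<epsilon> < 1/2" and k: "2 \<le> k"
    and sub: "cardinality_instances \<epsilon> k \<subseteq> \<I>" and rand: "randomized_online_algorithm \<I> M"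
  shows "ereal (ln 2 / 4 * (real k / ln (real k))) \<le> competitive_ratio \<I> (expected_ALG M)"
proof -
  \<comment> \<open>\<open>L\<close> is least with \<open>k \<le> 2 ^ L\<close>, and
    \<open>T\<close> is then the largest number of batches with
    \<open>(T - 1) * L < k\<close>.\<close>
  define L where "L = nat \<lceil>log 2 (real k)\<rceil>"
  define T where "T = (k - 1) div L + 1"
  have log: "1 \<le> log 2 (real k)" using k by simp
  have "real L < log 2 (real k) + 1" "log 2 (real k) \<le> real L"
    unfolding L_def using log by linarith+
  \<comment> \<open>Rounding up at most doubles the logarithm because \<open>k \<ge> 2\<close> makes
    it at least 1.\<close>
  then have L: "real L \<le> 2 * log 2 (real k)" "0 < L" "log 2 (real k) \<le> real L"
    using log by linarith+
  have "real k \<le> 2 powr real L" using L(3) k by (simp add: log_le_iff)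
  then have "real k \<le> real (2 ^ L)" by (simp add: powr_realpow)
  then have kL: "k \<le> 2 ^ L" by (simp only: of_nat_le_iff)
  have "(T - 1) * L \<le> k - 1" by (simp add: T_def)
  then have TL: "(T - 1) * L < k" using k by linarith
  have "(k - 1) div L \<le> k - 1" by simp
  then have T_le: "T \<le> 2 ^ L" using kL k unfolding T_def by linarith
  have "k - 1 < T * L"
    using dividend_less_div_times[OF L(2), of "k - 1"] by (simp add: T_def)
  then have "k \<le> T * L" by linarith
  then have "real k \<le> real T * real L" by (metis of_nat_le_iff of_nat_mult)
  also have "\<dots> \<le> real T * (2 * log 2 (real k))" using L(1) by (intro mult_left_mono) auto
  \<comment> \<open>From \<open>T \<ge> k / (2 * log 2 k)\<close>; halving gives the 4, and changing
    the base of the logarithm gives \<open>ln 2\<close>.\<close>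
  finally have "ln 2 / 4 * (real k / ln (real k)) \<le> real T / 2"
    using k by (simp add: log_def field_simps)
  then have "ereal (ln 2 / 4 * (real k / ln (real k))) \<le> ereal (real T / 2)" by simp
  also have "\<dots> \<le> competitive_ratio \<I> (expected_ALG M)"
    using randomized_lower_bound_batches[OF \<epsilon> TL _ T_le sub rand] by (simp add: T_def)
  finally show ?thesis .
qed

theorem theorem1p2:
  shows "(\<exists>c>0::real. \<forall>\<epsilon>::real. 0 < \<epsilon> \<and> \<epsilon> < 1/2 \<longrightarrow>
            (\<forall>k::nat. 1 \<le> k \<longrightarrow>
               (\<forall>\<I>\<in>{ovp_instances \<epsilon> k, cardinality_instances \<epsilon> k}. \<forall>A.
                  online_algorithm \<I> A \<longrightarrow>
                  ereal (c * real k) \<le> competitive_ratio \<I> (ALG A))))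
       \<and> (\<exists>c>0::real. \<forall>\<epsilon>::real. 0 < \<epsilon> \<and> \<epsilon> < 1/2 \<longrightarrow>
            (\<forall>k::nat. 2 \<le> k \<longrightarrow>
               (\<forall>\<I>\<in>{ovp_instances \<epsilon> k, cardinality_instances \<epsilon> k}. \<forall>M.
                  randomized_online_algorithm \<I> M \<longrightarrow>
                  ereal (c * (real k / ln (real k))) \<le> competitive_ratio \<I> (expected_ALG M))))"
proof -
  \<comment> \<open>Both adversaries use only cardinality instances, which belong to either class,
    so each bound is proved once for any larger class.\<close>
  have sub: "cardinality_instances \<epsilon> k \<subseteq> \<I>"
    if "\<I> \<in> {ovp_instances \<epsilon> k, cardinality_instances \<epsilon> k}" for \<epsilon> k \<I>
    using that by (auto simp: cardinality_instances_def)
  show ?thesis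
  proof (intro conjI)
    show "\<exists>c>0::real. \<forall>\<epsilon>::real. 0 < \<epsilon> \<and> \<epsilon> < 1/2 \<longrightarrow>
        (\<forall>k::nat. 1 \<le> k \<longrightarrow>
           (\<forall>\<I>\<in>{ovp_instances \<epsilon> k, cardinality_instances \<epsilon> k}. \<forall>A.
              online_algorithm \<I> A \<longrightarrow>
              ereal (c * real k) \<le> competitive_ratio \<I> (ALG A)))"
      using deterministic_lower_bound[OF _ _ _ sub] by (intro exI[of _ "1 / 2"]) auto
    show "\<exists>c>0::real. \<forall>\<epsilon>::real. 0 < \<epsilon> \<and> \<epsilon> < 1/2 \<longrightarrow>
        (\<forall>k::nat. 2 \<le> k \<longrightarrow>
           (\<forall>\<I>\<in>{ovp_instances \<epsilon> k, cardinality_instances \<epsilon> k}. \<forall>M.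
              randomized_online_algorithm \<I> M \<longrightarrow>
              ereal (c * (real k / ln (real k))) \<le> competitive_ratio \<I> (expected_ALG M)))"
      using randomized_lower_bound[OF _ _ _ sub] by (intro exI[of _ "ln 2 / 4"]) auto
  qed
qed

end
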